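(* Let $M,N\in\mathbb{N}$ with $M+N\geqslant3$, let $\mathfrak{g}=\mathfrak{gl}(M,N)$ be the general linear Lie superalgebra over $\mathbb{C}$, and let $B$ be an associative, commutative, finitely generated $\mathbb{C}$-algebra with unity. For $k\in\mathbb{N}$ and $a_1,\dots,a_k\in B$ put $$\widetilde{T}_k(a_1,\dots,a_k)=\sum_{(i_1,\dots,i_k)}(-1)^{p(i_2)+\cdots+p(i_k)}\,E_{i_1i_2}(a_1)\otimes E_{i_2i_3}(a_2)\otimes\cdots\otimes E_{i_ki_1}(a_k)\in T^k(\mathfrak{g}\otimes B),$$ the sum running over all $k$-tuples with $1\leqslant i_j\leqslant M+N$. Then $\operatorname{ad}x.\widetilde{T}_k(a_1,\dots,a_k)=0$ for all $x\in\mathfrak{g}$, all $k\in\mathbb{N}$ and all $a_1,\dots,a_k\in B$.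
   Context: $\mathfrak{gl}(M,N)=\operatorname{End}(V)$ for a $\mathbb{Z}_2$-graded space $V=V_{\bar0}\oplus V_{\bar1}$ with $\dim V_{\bar0}=M$, $\dim V_{\bar1}=N$, with super bracket $[f,g]=fg-(-1)^{|f||g|}gf$. $E_{ij}$ ($1\leqslant i,j\leqslant M+N$) are the standard matrix units with respect to a homogeneous basis; $p(i)=\bar0$ for $1\leqslant i\leqslant M$, $p(i)=\bar1$ for $M+1\leqslant i\leqslant M+N$, and $E_{ij}$ has parity $p(i)+p(j)$. $\mathfrak{g}\otimes B$ is the Lie superalgebra with bracket $[x\otimes a,y\otimes b]=[x,y]\otimes ab$; write $x(a)=x\otimes a$. $T^k(\mathfrak{g}\otimes B)=(\mathfrak{g}\otimes B)^{\otimes k}$ is the $k$-th component of the tensor algebra. $\mathfrak{g}\cong\mathfrak{g}\otimes\mathbb{C}1\subseteq\mathfrak{g}\otimes B$ acts on it by the super tensor product of adjoint actions, denoted $\operatorname{ad}$: for homogeneous $x\in\mathfrak{g}$ and homogeneous $w_j\in\mathfrak{g}\otimes B$, $$\operatorname{ad}x.(w_1\otimes\cdots\otimes w_k)=\sum_{r=1}^k(-1)^{|x|(|w_1|+\cdots+|w_{r-1}|)}w_1\otimes\cdots\otimes[x,w_r]\otimes\cdots\otimes w_k .$$ *)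

theory Defs
  imports
    "HOL-Analysis.Finite_Cartesian_Product"
    "HOL-Library.Poly_Mapping"
    "HOL-Library.Z2"
begin

section \<open>Complex vector spaces and commutative algebras\<close>

class complex_vector = ab_group_add +
  fixes scaleC :: "complex \<Rightarrow> 'a \<Rightarrow> 'a"  (infixr \<open>*\<^sub>C\<close> 75)
  assumes scaleC_add_right: "c *\<^sub>C (x + y) = c *\<^sub>C x + c *\<^sub>C y"
    and scaleC_add_left: "(c + d) *\<^sub>C x = c *\<^sub>C x + d *\<^sub>C x"
    and scaleC_scaleC: "c *\<^sub>C d *\<^sub>C x = (c * d) *\<^sub>C x"
    and scaleC_one: "1 *\<^sub>C x = x"

global_interpretation complex_vector:
  vector_space "scaleC :: complex \<Rightarrow> 'a \<Rightarrow> 'a :: complex_vector"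
  by unfold_locales (simp_all add: scaleC_add_right scaleC_add_left scaleC_scaleC scaleC_one)

text \<open>
  Based on \<^class>\<open>comm_ring\<close> with a unit rather than on \<^class>\<open>comm_ring_1\<close>, because the latter
  excludes the zero algebra.
\<close>

class comm_complex_algebra = complex_vector + comm_ring + comm_monoid_mult +
  assumes scaleC_mult_left: "(c *\<^sub>C x) * y = c *\<^sub>C (x * y)"

definition complex_subalgebra :: "'b::comm_complex_algebra set \<Rightarrow> bool" where
  "complex_subalgebra A \<longleftrightarrow>
     1 \<in> A \<and> (\<forall>x\<in>A. \<forall>y\<in>A. x + y \<in> A \<and> x * y \<in> A) \<and> (\<forall>c. \<forall>x\<in>A. c *\<^sub>C x \<in> A)"

definition finitely_generated_algebra :: "'b::comm_complex_algebra itself \<Rightarrow> bool" where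
  "finitely_generated_algebra _ \<longleftrightarrow>
     (\<exists>S :: 'b set. finite S \<and> complex_subalgebra hull S = UNIV)"

instantiation complex :: comm_complex_algebra
begin
definition scaleC_complex :: "complex \<Rightarrow> complex \<Rightarrow> complex" where
  "scaleC_complex c x = c * x"
instance
  by standard (simp_all add: scaleC_complex_def algebra_simps)
end

instantiation vec :: (complex_vector, finite) complex_vector
begin
definition scaleC_vec :: "complex \<Rightarrow> 'a ^ 'b \<Rightarrow> 'a ^ 'b" where
  "scaleC_vec c x = (\<chi> i. c *\<^sub>C (x $ i))"
instance
  by standard
    (simp_all add: scaleC_vec_def vec_eq_iff scaleC_add_right scaleC_add_left scaleC_scaleC scaleC_one)
end

text \<open>
  The type of finitely supported functions \<^typ>\<open>'x \<Rightarrow>\<^sub>0 complex\<close> is the free complex vector space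
  on \<^typ>\<open>'x\<close>, with basis the functions \<^term>\<open>Poly_Mapping.single x 1\<close>.
\<close>

instantiation poly_mapping :: (type, complex_vector) complex_vector
begin
definition scaleC_poly_mapping :: "complex \<Rightarrow> ('a \<Rightarrow>\<^sub>0 'b) \<Rightarrow> 'a \<Rightarrow>\<^sub>0 'b" where
  "scaleC_poly_mapping c f = Poly_Mapping.map (scaleC c) f"

lemma lookup_scaleC [simp]: "Poly_Mapping.lookup (c *\<^sub>C f) x = c *\<^sub>C Poly_Mapping.lookup f x"
  by (simp add: scaleC_poly_mapping_def Poly_Mapping.map.rep_eq when_def)

instance
  by standard
    (rule poly_mapping_eqI,
     simp add: lookup_add scaleC_add_right scaleC_add_left scaleC_scaleC scaleC_one)+
end

definition free_lift :: "('x \<Rightarrow> 'c::complex_vector) \<Rightarrow> ('x \<Rightarrow>\<^sub>0 complex) \<Rightarrow> 'c" where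
  "free_lift f u = (\<Sum>x\<in>Poly_Mapping.keys u. Poly_Mapping.lookup u x *\<^sub>C f x)"

lemma free_lift_superset:
  assumes "finite A" "Poly_Mapping.keys u \<subseteq> A"
  shows "free_lift f u = (\<Sum>x\<in>A. Poly_Mapping.lookup u x *\<^sub>C f x)"
  unfolding free_lift_def using assms
  by (intro sum.mono_neutral_left) (auto simp: in_keys_iff)

lemma free_lift_add: "free_lift f (u + v) = free_lift f u + free_lift f v"
proof -
  have "Poly_Mapping.keys (u + v) \<subseteq> Poly_Mapping.keys u \<union> Poly_Mapping.keys v" by (rule Poly_Mapping.keys_add)
  then show ?thesis
    by (simp add: free_lift_superset[where A = "Poly_Mapping.keys u \<union> Poly_Mapping.keys v"] lookup_add scaleC_add_left
        sum.distrib)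
qed

lemma free_lift_scaleC: "free_lift f (c *\<^sub>C u) = c *\<^sub>C free_lift f u"
proof -
  have "Poly_Mapping.keys (c *\<^sub>C u) \<subseteq> Poly_Mapping.keys u" by (auto simp: in_keys_iff scaleC_complex_def)
  then show ?thesis
    by (simp add: free_lift_superset[where A = "Poly_Mapping.keys u"] complex_vector.scale_sum_right
        scaleC_complex_def)
qed

lemma free_lift_diff: "free_lift f (u - v) = free_lift f u - free_lift f v"
  using free_lift_add[of f "u - v" v] by simp

lemma free_lift_single [simp]: "free_lift f (Poly_Mapping.single x c) = c *\<^sub>C f x"
  by (cases "c = 0") (simp_all add: free_lift_def)

lemma free_lift_span_eq_0:
  assumes "u \<in> complex_vector.span R" "\<And>r. r \<in> R \<Longrightarrow> free_lift f r = 0"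
  shows "free_lift f u = 0"
  using assms(1)
proof (induction rule: complex_vector.span_induct_alt)
  case base
  then show ?case by (simp add: free_lift_def)
next
  case (step c x y)
  then show ?case by (simp add: free_lift_add free_lift_scaleC assms(2))
qed


section \<open>Tensor products\<close>

abbreviation "basis_vec x \<equiv> Poly_Mapping.single x (1::complex)"

inductive_set tensor_relators ::
  "(('a::complex_vector \<times> 'b::complex_vector) \<Rightarrow>\<^sub>0 complex) set" where
  "basis_vec (x + x', y) - (basis_vec (x, y) + basis_vec (x', y)) \<in> tensor_relators"
| "basis_vec (x, y + y') - (basis_vec (x, y) + basis_vec (x, y')) \<in> tensor_relators"
| "basis_vec (c *\<^sub>C x, y) - c *\<^sub>C basis_vec (x, y) \<in> tensor_relators"
| "basis_vec (x, c *\<^sub>C y) - c *\<^sub>C basis_vec (x, y) \<in> tensor_relators"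

definition tensor_rel ::
  "(('a::complex_vector \<times> 'b::complex_vector) \<Rightarrow>\<^sub>0 complex) \<Rightarrow> (('a \<times> 'b) \<Rightarrow>\<^sub>0 complex) \<Rightarrow> bool" where
  "tensor_rel u v \<longleftrightarrow> u - v \<in> complex_vector.span tensor_relators"

lemma equivp_diff_in_span: "equivp (\<lambda>u v. u - v \<in> complex_vector.span R)"
proof (rule equivpI)
  show "reflp (\<lambda>u v. u - v \<in> complex_vector.span R)"
    by (simp add: reflp_def complex_vector.span_zero)
  show "symp (\<lambda>u v. u - v \<in> complex_vector.span R)"
    by (metis (lifting) complex_vector.span_neg minus_diff_eq sympI)
  show "transp (\<lambda>u v. u - v \<in> complex_vector.span R)"
  proof (rule transpI)
    fix u v w assume "u - v \<in> complex_vector.span R" "v - w \<in> complex_vector.span R"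
    from complex_vector.span_add[OF this] show "u - w \<in> complex_vector.span R" by simp
  qed
qed

lemma diff_in_span_add:
  assumes "u - v \<in> complex_vector.span R" "u' - v' \<in> complex_vector.span R"
  shows "(u + u') - (v + v') \<in> complex_vector.span R"
  using complex_vector.span_add[OF assms] by (simp add: algebra_simps)

lemma diff_in_span_scaleC:
  assumes "u - v \<in> complex_vector.span R"
  shows "c *\<^sub>C u - c *\<^sub>C v \<in> complex_vector.span R"
  using complex_vector.span_scale[OF assms, of c] by (simp add: complex_vector.scale_right_diff_distrib)

lemma diff_in_span_uminus:
  assumes "u - v \<in> complex_vector.span R"
  shows "- u - - v \<in> complex_vector.span R"
  using complex_vector.span_neg[OF assms] by simp

lemma diff_in_span_diff:
  assumes "u - v \<in> complex_vector.span R" "u' - v' \<in> complex_vector.span R"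
  shows "(u - u') - (v - v') \<in> complex_vector.span R"
  using complex_vector.span_diff[OF assms] by (simp add: algebra_simps)

quotient_type (overloaded) ('a, 'b) tensor =
  "('a::complex_vector \<times> 'b::complex_vector) \<Rightarrow>\<^sub>0 complex" / tensor_rel
  unfolding tensor_rel_def [abs_def] by (rule equivp_diff_in_span)

instantiation tensor :: (complex_vector, complex_vector) complex_vector
begin
lift_definition zero_tensor :: "('a, 'b) tensor" is 0 .
lift_definition plus_tensor :: "('a, 'b) tensor \<Rightarrow> ('a, 'b) tensor \<Rightarrow> ('a, 'b) tensor" is "(+)"
  unfolding tensor_rel_def by (rule diff_in_span_add)
lift_definition minus_tensor :: "('a, 'b) tensor \<Rightarrow> ('a, 'b) tensor \<Rightarrow> ('a, 'b) tensor" is "(-)"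
  unfolding tensor_rel_def by (rule diff_in_span_diff)
lift_definition uminus_tensor :: "('a, 'b) tensor \<Rightarrow> ('a, 'b) tensor" is uminus
  unfolding tensor_rel_def by (rule diff_in_span_uminus)
lift_definition scaleC_tensor :: "complex \<Rightarrow> ('a, 'b) tensor \<Rightarrow> ('a, 'b) tensor" is scaleC
  unfolding tensor_rel_def by (rule diff_in_span_scaleC)
instance
  by standard (transfer; simp add: tensor_rel_def complex_vector.span_zero algebra_simps
      scaleC_add_right scaleC_add_left scaleC_scaleC scaleC_one)+
end

lift_definition tensor :: "'a::complex_vector \<Rightarrow> 'b::complex_vector \<Rightarrow> ('a, 'b) tensor"
    (infixl \<open>\<otimes>\<^sub>C\<close> 72)
  is "\<lambda>x y. basis_vec (x, y)" .

text \<open>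
  The linear map induced by a bilinear map \<^term>\<open>f\<close>; for \<^term>\<open>f\<close> that is not bilinear the value
  depends on the chosen representative and has no meaning.
\<close>

definition tensor_lift ::
  "('a::complex_vector \<Rightarrow> 'b::complex_vector \<Rightarrow> 'c::complex_vector) \<Rightarrow> ('a, 'b) tensor \<Rightarrow> 'c" where
  "tensor_lift f t = free_lift (\<lambda>(x, y). f x y) (rep_tensor t)"

definition bilinearC ::
  "('a::complex_vector \<Rightarrow> 'b::complex_vector \<Rightarrow> 'c::complex_vector) \<Rightarrow> bool" where
  "bilinearC f \<longleftrightarrow>
     (\<forall>x x' y. f (x + x') y = f x y + f x' y) \<and> (\<forall>x y y'. f x (y + y') = f x y + f x y') \<and>
     (\<forall>c x y. f (c *\<^sub>C x) y = c *\<^sub>C f x y) \<and> (\<forall>c x y. f x (c *\<^sub>C y) = c *\<^sub>C f x y)"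

lemma tensor_lift_abs:
  assumes "bilinearC f"
  shows "tensor_lift f (abs_tensor u) = free_lift (\<lambda>(x, y). f x y) u"
proof -
  have "tensor_rel (rep_tensor (abs_tensor u)) u"
    using Quotient3_tensor by (metis Quotient3_rep_abs tensor.abs_eq_iff tensor_equivp equivp_reflp)
  then have "rep_tensor (abs_tensor u) - u \<in> complex_vector.span tensor_relators"
    by (simp add: tensor_rel_def)
  then have "free_lift (\<lambda>(x, y). f x y) (rep_tensor (abs_tensor u) - u) = 0"
  proof (rule free_lift_span_eq_0)
    fix r :: "('a \<times> 'b) \<Rightarrow>\<^sub>0 complex" assume "r \<in> tensor_relators"
    then show "free_lift (\<lambda>(x, y). f x y) r = 0"
      using assms unfolding bilinearC_def
      by cases (simp_all add: free_lift_diff free_lift_add free_lift_scaleC scaleC_one)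
  qed
  then show ?thesis by (simp add: tensor_lift_def free_lift_diff)
qed

lemma tensor_lift_tensor: "bilinearC f \<Longrightarrow> tensor_lift f (x \<otimes>\<^sub>C y) = f x y"
  by (simp add: tensor.abs_eq tensor_lift_abs scaleC_one)

lemma tensor_lift_add:
  assumes "bilinearC f" shows "tensor_lift f (s + t) = tensor_lift f s + tensor_lift f t"
  by (induction s; induction t)
    (simp add: plus_tensor.abs_eq tensor_lift_abs[OF assms] free_lift_add)

lemma tensor_lift_scaleC:
  assumes "bilinearC f" shows "tensor_lift f (c *\<^sub>C t) = c *\<^sub>C tensor_lift f t"
  by (induction t)
    (simp add: scaleC_tensor.abs_eq tensor_lift_abs[OF assms] free_lift_scaleC)

lemma tensor_bilinear: "bilinearC (\<otimes>\<^sub>C)"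
  unfolding bilinearC_def
  by (intro conjI allI; transfer; simp add: tensor_rel_def;
      intro complex_vector.span_base tensor_relators.intros)


section \<open>The tensor algebra\<close>

text \<open>
  The tensor algebra is built as the quotient of the free vector space on words by the relations
  expressing linearity in each letter. The relators are homogeneous in the length of the words, so
  the classes of the words of length \<^term>\<open>k\<close> span the component of degree \<^term>\<open>k\<close>, and the
  whole is the direct sum of these components.
\<close>

inductive_set talg_relators :: "('a::complex_vector list \<Rightarrow>\<^sub>0 complex) set" where
  "basis_vec (us @ (x + y) # vs) - (basis_vec (us @ x # vs) + basis_vec (us @ y # vs))
     \<in> talg_relators"
| "basis_vec (us @ (c *\<^sub>C x) # vs) - c *\<^sub>C basis_vec (us @ x # vs) \<in> talg_relators"

definition talg_rel ::
  "('a::complex_vector list \<Rightarrow>\<^sub>0 complex) \<Rightarrow> ('a list \<Rightarrow>\<^sub>0 complex) \<Rightarrow> bool" where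
  "talg_rel u v \<longleftrightarrow> u - v \<in> complex_vector.span talg_relators"

quotient_type (overloaded) 'a tensor_algebra = "'a::complex_vector list \<Rightarrow>\<^sub>0 complex" / talg_rel
  unfolding talg_rel_def [abs_def] by (rule equivp_diff_in_span)

instantiation tensor_algebra :: (complex_vector) complex_vector
begin
lift_definition zero_tensor_algebra :: "'a tensor_algebra" is 0 .
lift_definition plus_tensor_algebra :: "'a tensor_algebra \<Rightarrow> 'a tensor_algebra \<Rightarrow> 'a tensor_algebra"
  is "(+)" unfolding talg_rel_def by (rule diff_in_span_add)
lift_definition minus_tensor_algebra :: "'a tensor_algebra \<Rightarrow> 'a tensor_algebra \<Rightarrow> 'a tensor_algebra"
  is "(-)" unfolding talg_rel_def by (rule diff_in_span_diff)
lift_definition uminus_tensor_algebra :: "'a tensor_algebra \<Rightarrow> 'a tensor_algebra"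
  is uminus unfolding talg_rel_def by (rule diff_in_span_uminus)
lift_definition scaleC_tensor_algebra :: "complex \<Rightarrow> 'a tensor_algebra \<Rightarrow> 'a tensor_algebra"
  is scaleC unfolding talg_rel_def by (rule diff_in_span_scaleC)
instance
  by standard (transfer; simp add: talg_rel_def complex_vector.span_zero algebra_simps
      scaleC_add_right scaleC_add_left scaleC_scaleC scaleC_one)+
end

lift_definition tprod :: "'a::complex_vector list \<Rightarrow> 'a tensor_algebra" is basis_vec .

definition tensor_power :: "nat \<Rightarrow> 'a::complex_vector tensor_algebra set" where
  "tensor_power k = complex_vector.span (tprod ` {ws. length ws = k})"

text \<open>The linear map given on each component by a multilinear map, as for \<^const>\<open>tensor_lift\<close>.\<close>

definition talg_lift ::
  "('a::complex_vector list \<Rightarrow> 'c::complex_vector) \<Rightarrow> 'a tensor_algebra \<Rightarrow> 'c" where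
  "talg_lift f t = free_lift f (rep_tensor_algebra t)"

definition multilinearC :: "('a::complex_vector list \<Rightarrow> 'c::complex_vector) \<Rightarrow> bool" where
  "multilinearC f \<longleftrightarrow>
     (\<forall>us vs x y. f (us @ (x + y) # vs) = f (us @ x # vs) + f (us @ y # vs)) \<and>
     (\<forall>us vs c x. f (us @ (c *\<^sub>C x) # vs) = c *\<^sub>C f (us @ x # vs))"

lemma multilinearC_scale: "multilinearC f \<Longrightarrow> multilinearC (\<lambda>ws. c *\<^sub>C f ws)"
  by (simp add: multilinearC_def scaleC_add_right scaleC_scaleC mult.commute)

lemma multilinearC_sum_length:
  assumes "\<And>n i. i \<in> I n \<Longrightarrow> multilinearC (f i)"
  shows "multilinearC (\<lambda>ws. \<Sum>i\<in>I (length ws). f i ws)"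
  using assms unfolding multilinearC_def
  by (simp add: complex_vector.scale_sum_right flip: sum.distrib)

lemma talg_lift_abs:
  assumes "multilinearC f"
  shows "talg_lift f (abs_tensor_algebra u) = free_lift f u"
proof -
  have "talg_rel (rep_tensor_algebra (abs_tensor_algebra u)) u"
    using Quotient3_tensor_algebra
    by (metis Quotient3_rep_abs tensor_algebra.abs_eq_iff tensor_algebra_equivp equivp_reflp)
  then have "rep_tensor_algebra (abs_tensor_algebra u) - u \<in> complex_vector.span talg_relators"
    by (simp add: talg_rel_def)
  then have "free_lift f (rep_tensor_algebra (abs_tensor_algebra u) - u) = 0"
  proof (rule free_lift_span_eq_0)
    fix r :: "'a list \<Rightarrow>\<^sub>0 complex" assume "r \<in> talg_relators"
    then show "free_lift f r = 0"
      using assms unfolding multilinearC_def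
      by cases (simp_all add: free_lift_diff free_lift_add free_lift_scaleC scaleC_one)
  qed
  then show ?thesis by (simp add: talg_lift_def free_lift_diff)
qed

lemma talg_lift_tprod: "multilinearC f \<Longrightarrow> talg_lift f (tprod ws) = f ws"
  by (simp add: tprod.abs_eq talg_lift_abs scaleC_one)

lemma talg_lift_add:
  assumes "multilinearC f" shows "talg_lift f (s + t) = talg_lift f s + talg_lift f t"
  by (induction s; induction t)
    (simp add: plus_tensor_algebra.abs_eq talg_lift_abs[OF assms] free_lift_add)

lemma talg_lift_scaleC:
  assumes "multilinearC f" shows "talg_lift f (c *\<^sub>C t) = c *\<^sub>C talg_lift f t"
  by (induction t)
    (simp add: scaleC_tensor_algebra.abs_eq talg_lift_abs[OF assms] free_lift_scaleC)

lemma tprod_multilinear: "multilinearC tprod"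
  unfolding multilinearC_def
  by (intro conjI allI; transfer; simp add: talg_rel_def;
      intro complex_vector.span_base talg_relators.intros)


section \<open>The general linear Lie superalgebra\<close>

text \<open>
  The grading on the underlying space with basis indexed by \<^typ>\<open>'i\<close> is given by the parities
  \<^term>\<open>p i\<close> of the basis vectors.
\<close>

type_synonym 'i gl = "complex ^ 'i ^ 'i"

definition msign :: "bit \<Rightarrow> complex" where
  "msign d = (if d = 0 then 1 else -1)"

definition matrix_unit :: "'i::finite \<Rightarrow> 'i \<Rightarrow> 'i gl" where
  "matrix_unit i j = (\<chi> r s. if r = i \<and> s = j then 1 else 0)"

definition gl_part :: "('i::finite \<Rightarrow> bit) \<Rightarrow> bit \<Rightarrow> 'i gl \<Rightarrow> 'i gl" where
  "gl_part p d x = (\<chi> r s. if p r + p s = d then x $ r $ s else 0)"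

definition gl_bracket :: "('i::finite \<Rightarrow> bit) \<Rightarrow> 'i gl \<Rightarrow> 'i gl \<Rightarrow> 'i gl" where
  "gl_bracket p x y =
     (\<Sum>d\<in>UNIV. \<Sum>e\<in>UNIV.
        gl_part p d x ** gl_part p e y - msign (d * e) *\<^sub>C (gl_part p e y ** gl_part p d x))"


section \<open>The Lie superalgebra of the tensor product with a commutative algebra\<close>

type_synonym ('i, 'b) gl_tensor = "('i gl, 'b) tensor"

definition current_part ::
  "('i::finite \<Rightarrow> bit) \<Rightarrow> bit \<Rightarrow> ('i, 'b::comm_complex_algebra) gl_tensor \<Rightarrow> ('i, 'b) gl_tensor" where
  "current_part p d = tensor_lift (\<lambda>x a. gl_part p d x \<otimes>\<^sub>C a)"

definition current_bracket ::
  "('i::finite \<Rightarrow> bit) \<Rightarrow> ('i, 'b::comm_complex_algebra) gl_tensor \<Rightarrow> ('i, 'b) gl_tensor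
     \<Rightarrow> ('i, 'b) gl_tensor" where
  "current_bracket p v w =
     tensor_lift (\<lambda>x a. tensor_lift (\<lambda>y b. gl_bracket p x y \<otimes>\<^sub>C (a * b)) w) v"

lemma gl_part_add: "gl_part p d (x + y) = gl_part p d x + gl_part p d y"
  by (simp add: gl_part_def vec_eq_iff)

lemma gl_part_scaleC: "gl_part p d (c *\<^sub>C x) = c *\<^sub>C gl_part p d x"
  by (simp add: gl_part_def vec_eq_iff scaleC_vec_def scaleC_complex_def)

lemma gl_part_gl_part: "gl_part p d (gl_part p e x) = (if d = e then gl_part p d x else 0)"
  by (simp add: gl_part_def vec_eq_iff)

lemma UNIV_bit: "(UNIV :: bit set) = {0, 1}"
  by (auto intro: bit.exhaust)

lemma finite_UNIV_bit: "finite (UNIV :: bit set)"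
  unfolding UNIV_bit by simp

lemma sum_UNIV_bit: "(\<Sum>d\<in>(UNIV :: bit set). f d) = f 0 + f 1"
  unfolding UNIV_bit by simp

lemma gl_bracket_bilinear: "bilinearC (gl_bracket p)"
proof -
  have l: "(x + y) ** z = x ** z + y ** z" for x y z :: "'a gl"
    by (simp add: matrix_matrix_mult_def vec_eq_iff algebra_simps sum.distrib)
  have s: "(c *\<^sub>C x) ** z = c *\<^sub>C (x ** z)" "x ** (c *\<^sub>C z) = c *\<^sub>C (x ** z)" for c and x z :: "'a gl"
    by (simp_all add: matrix_matrix_mult_def vec_eq_iff scaleC_vec_def scaleC_complex_def
        algebra_simps sum_distrib_left)
  show ?thesis
    unfolding bilinearC_def gl_bracket_def sum_UNIV_bit gl_part_add gl_part_scaleC l s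
      matrix_add_ldistrib
    by (simp add: scaleC_add_right complex_vector.scale_right_diff_distrib algebra_simps)
qed

lemma gl_bracket_homogeneous:
  assumes "gl_part p d x = x" "gl_part p e y = y"
  shows "gl_bracket p x y = x ** y - msign (d * e) *\<^sub>C (y ** x)"
proof -
  have other: "gl_part p d' z = (if d' = d then z else 0)" if "gl_part p d z = z" for d d' z
    using gl_part_gl_part[of p d' d z] that by auto
  show ?thesis
    unfolding gl_bracket_def sum_UNIV_bit
    by (cases d; cases e) (simp_all add: other[OF assms(1)] other[OF assms(2)])
qed

lemma scaleC_mult_right: "x * (c *\<^sub>C y) = c *\<^sub>C (x * y)" for x y :: "'b::comm_complex_algebra"
  by (metis scaleC_mult_left mult.commute)

lemma bilinearC_bracket_right:
  "bilinearC (\<lambda>y b. gl_bracket p x y \<otimes>\<^sub>C (a * b :: 'b::comm_complex_algebra))"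
  using gl_bracket_bilinear[of p] tensor_bilinear[where 'a = "'a gl" and 'b = 'b]
  by (simp add: bilinearC_def ring_distribs scaleC_mult_right)

lemma bilinearC_bracket_left:
  "bilinearC (\<lambda>x a. tensor_lift (\<lambda>y b. gl_bracket p x y \<otimes>\<^sub>C (a * b :: 'b::comm_complex_algebra)) w)"
proof -
  have *: "tensor_lift (\<lambda>y b. gl_bracket p x y \<otimes>\<^sub>C (a * b)) (abs_tensor u) =
      free_lift (\<lambda>(y, b). gl_bracket p x y \<otimes>\<^sub>C (a * b)) u" for x u and a :: 'b
    by (rule tensor_lift_abs[OF bilinearC_bracket_right])
  show ?thesis
    using gl_bracket_bilinear[of p] tensor_bilinear[where 'a = "'a gl" and 'b = 'b]
    by (induction w)
      (simp add: bilinearC_def * free_lift_def ring_distribs scaleC_mult_left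
        scaleC_mult_right split_def
        scaleC_add_right sum.distrib complex_vector.scale_sum_right scaleC_scaleC mult_ac)
qed

lemma current_bracket_tensor:
  "current_bracket p (x \<otimes>\<^sub>C a) (y \<otimes>\<^sub>C b) = gl_bracket p x y \<otimes>\<^sub>C (a * b)"
  unfolding current_bracket_def tensor_lift_tensor[OF bilinearC_bracket_left]
  by (rule tensor_lift_tensor[OF bilinearC_bracket_right])

lemma bilinearC_current_part:
  "bilinearC (\<lambda>x (a :: 'b::comm_complex_algebra). gl_part p d x \<otimes>\<^sub>C a)"
  using tensor_bilinear[where 'a = "'a gl" and 'b = 'b]
  by (simp add: bilinearC_def gl_part_add gl_part_scaleC)

lemma current_part_tensor: "current_part p d (x \<otimes>\<^sub>C a) = gl_part p d x \<otimes>\<^sub>C a"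
  unfolding current_part_def by (simp add: tensor_lift_tensor[OF bilinearC_current_part])

lemma current_bracket_linear:
  "current_bracket p v (w + w') = current_bracket p v w + current_bracket p v w'"
  "current_bracket p v (c *\<^sub>C w) = c *\<^sub>C current_bracket p v w"
proof -
  show "current_bracket p v (w + w') = current_bracket p v w + current_bracket p v w'"
    unfolding current_bracket_def tensor_lift_add[OF bilinearC_bracket_right]
    by (simp add: tensor_lift_def free_lift_def split_def scaleC_add_right sum.distrib)
  show "current_bracket p v (c *\<^sub>C w) = c *\<^sub>C current_bracket p v w"
    unfolding current_bracket_def tensor_lift_scaleC[OF bilinearC_bracket_right]
    by (simp add: tensor_lift_def free_lift_def split_def complex_vector.scale_sum_right
        scaleC_scaleC mult_ac)
qed

lemma current_part_linear:
  "current_part p d (w + w') = current_part p d w + current_part p d w'"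
  "current_part p d (c *\<^sub>C w) = c *\<^sub>C current_part p d w"
  unfolding current_part_def
  by (simp_all add: tensor_lift_add[OF bilinearC_current_part]
      tensor_lift_scaleC[OF bilinearC_current_part])


section \<open>The adjoint action on the tensor algebra\<close>

text \<open>
  In \<open>ad_homogeneous\<close>, \<^term>\<open>d\<close> and \<^term>\<open>ds\<close> are the degrees of \<^term>\<open>x\<close> and of the letters of
  \<^term>\<open>ws\<close>; \<open>ad\<close> decomposes all arguments into homogeneous parts.
\<close>

definition ad_homogeneous ::
  "('i::finite \<Rightarrow> bit) \<Rightarrow> bit \<Rightarrow> 'i gl \<Rightarrow> bit list \<Rightarrow> ('i, 'b::comm_complex_algebra) gl_tensor list
     \<Rightarrow> ('i, 'b) gl_tensor tensor_algebra" where
  "ad_homogeneous p d x ds ws =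
     (\<Sum>r<length ws. msign (d * sum_list (take r ds)) *\<^sub>C
        tprod (ws[r := current_bracket p (x \<otimes>\<^sub>C 1) (ws ! r)]))"

definition ad ::
  "('i::finite \<Rightarrow> bit) \<Rightarrow> 'i gl \<Rightarrow> ('i, 'b::comm_complex_algebra) gl_tensor tensor_algebra
     \<Rightarrow> ('i, 'b) gl_tensor tensor_algebra" where
  "ad p x =
     talg_lift (\<lambda>ws. \<Sum>d\<in>UNIV. \<Sum>ds | length ds = length ws.
        ad_homogeneous p d (gl_part p d x) ds (map2 (current_part p) ds ws))"

lemma multilinearC_update:
  assumes F: "multilinearC F"
    and L: "\<And>x y. L (x + y) = L x + L y" "\<And>c x. L (c *\<^sub>C x) = c *\<^sub>C L x"
  shows "multilinearC (\<lambda>ws. F (ws[r := L (ws ! r)]))"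
proof -
  have split: "(us @ x # vs)[r := L ((us @ x # vs) ! r)] =
      (if r < length us then us[r := L (us ! r)] @ x # vs
       else if r = length us then us @ L x # vs
       else us @ x # vs[r - Suc (length us) := L (vs ! (r - Suc (length us)))])" for us x vs
  proof -
    consider "r < length us" | "r = length us" | k where "r = length us + Suc k"
      by (metis less_iff_Suc_add linorder_neqE_nat add_Suc_right)
    then show ?thesis by cases (simp_all add: nth_append list_update_append)
  qed
  show ?thesis
    using F unfolding multilinearC_def split by (simp add: L)
qed

lemma multilinearC_sum_map2:
  fixes G :: "bit list \<Rightarrow> 'a::complex_vector list \<Rightarrow> 'c::complex_vector"
  assumes G: "\<And>ds. multilinearC (G ds)"
    and L: "\<And>d x y. L d (x + y) = L d x + L d y" "\<And>d c x. L d (c *\<^sub>C x) = c *\<^sub>C L d x"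
  shows "multilinearC (\<lambda>ws. \<Sum>ds | length ds = length ws. G ds (map2 L ds ws))"
proof -
  have add: "G ds (map2 L ds (us @ (x + y) # vs)) =
      G ds (map2 L ds (us @ x # vs)) + G ds (map2 L ds (us @ y # vs))"
    and scale: "G ds (map2 L ds (us @ (c *\<^sub>C x) # vs)) = c *\<^sub>C G ds (map2 L ds (us @ x # vs))"
    if "length ds = Suc (length us + length vs)" for ds us vs x y c
  proof -
    have ds: "ds = take (length us) ds @ ds ! length us # drop (Suc (length us)) ds"
      using that by (simp add: id_take_nth_drop)
    have *: "map2 L ds (us @ z # vs) =
        map2 L (take (length us) ds) us @ L (ds ! length us) z # map2 L (drop (Suc (length us)) ds) vs"
      for z
      using that by (subst ds) (simp add: min_def)
    show "G ds (map2 L ds (us @ (x + y) # vs)) =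
        G ds (map2 L ds (us @ x # vs)) + G ds (map2 L ds (us @ y # vs))"
      and "G ds (map2 L ds (us @ (c *\<^sub>C x) # vs)) = c *\<^sub>C G ds (map2 L ds (us @ x # vs))"
      using G[of ds] unfolding * L multilinearC_def by blast+
  qed
  show ?thesis
    unfolding multilinearC_def
    by (simp add: add scale sum.distrib complex_vector.scale_sum_right)
qed

lemma ad_homogeneous_multilinear: "multilinearC (ad_homogeneous p d x ds)"
proof -
  have "multilinearC (\<lambda>ws. tprod (ws[r := current_bracket p (x \<otimes>\<^sub>C 1) (ws ! r)]))" for r
    by (intro multilinearC_update tprod_multilinear current_bracket_linear)
  then show ?thesis
    unfolding ad_homogeneous_def
    by (intro multilinearC_sum_length[where I = lessThan] multilinearC_scale)
qed

lemma ad_multilinear: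
  "multilinearC (\<lambda>ws. \<Sum>d\<in>UNIV. \<Sum>ds | length ds = length ws.
     ad_homogeneous p d (gl_part p d x) ds (map2 (current_part p) ds ws))"
proof -
  have "multilinearC (\<lambda>ws. \<Sum>ds | length ds = length ws.
     ad_homogeneous p d (gl_part p d x) ds (map2 (current_part p) ds ws))" for d
    by (intro multilinearC_sum_map2 ad_homogeneous_multilinear current_part_linear)
  then show ?thesis
    by (intro multilinearC_sum_length[where I = "\<lambda>_. UNIV"])
qed

lemma ad_add: "ad p x (s + t) = ad p x s + ad p x t"
  unfolding ad_def by (rule talg_lift_add[OF ad_multilinear])

lemma ad_scaleC: "ad p x (c *\<^sub>C t) = c *\<^sub>C ad p x t"
  unfolding ad_def by (rule talg_lift_scaleC[OF ad_multilinear])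

lemma multilinearC_zero: "multilinearC F \<Longrightarrow> 0 \<in> set ws \<Longrightarrow> F ws = 0"
  unfolding multilinearC_def
  by (metis complex_vector.scale_zero_left in_set_conv_decomp)

lemma current_part_current_part:
  "current_part p d (current_part p e w) = (if d = e then current_part p d w else 0)"
proof (induction w)
  fix u :: "('a gl \<times> 'b) \<Rightarrow>\<^sub>0 complex"
  have lin: "module_hom scaleC scaleC (current_part p d :: ('a, 'b) gl_tensor \<Rightarrow> _)"
    by unfold_locales (rule current_part_linear)+
  have z: "(0 :: 'a gl) \<otimes>\<^sub>C (a :: 'b) = 0" for a
    using tensor_bilinear[where 'a = "'a gl" and 'b = 'b] unfolding bilinearC_def
    by (metis complex_vector.scale_zero_left)
  have part: "current_part p d' (abs_tensor u) = (\<Sum>q\<in>Poly_Mapping.keys u.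
      Poly_Mapping.lookup u q *\<^sub>C (gl_part p d' (fst q) \<otimes>\<^sub>C snd q))" for d'
    unfolding current_part_def tensor_lift_abs[OF bilinearC_current_part]
    by (simp add: free_lift_def split_def)
  show "current_part p d (current_part p e (abs_tensor u)) =
      (if d = e then current_part p d (abs_tensor u) else 0)"
    by (simp add: part module_hom.sum[OF lin] current_part_linear current_part_tensor gl_part_gl_part z)
qed

text \<open>
  On homogeneous arguments \<^const>\<open>ad\<close> is given by the usual formula with Koszul signs.
\<close>

lemma ad_tprod_homogeneous:
  assumes x: "gl_part p d x = x"
    and len: "length ds = length ws"
    and ws: "\<And>r. r < length ws \<Longrightarrow> current_part p (ds ! r) (ws ! r) = ws ! r"
  shows "ad p x (tprod ws) =
    (\<Sum>r<length ws. msign (d * sum_list (take r ds)) *\<^sub>C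
       tprod (ws[r := current_bracket p (x \<otimes>\<^sub>C 1) (ws ! r)]))"
proof -
  have fin: "finite {es :: bit list. length es = length ws}"
    using finite_lists_length_eq[of "UNIV :: bit set" "length ws"] finite_UNIV_bit by simp
  have vanish: "ad_homogeneous p d' y es (map2 (current_part p) es ws) = 0"
    if es: "length es = length ws" "es \<noteq> ds" for d' y es
  proof -
    obtain r where r: "r < length ws" "es ! r \<noteq> ds ! r"
      using es len by (metis nth_equalityI)
    have "current_part p (es ! r) (ws ! r) = 0"
      using current_part_current_part[of p "es ! r" "ds ! r" "ws ! r"] r ws by simp
    then have "0 \<in> set (map2 (current_part p) es ws)"
      using r es by (metis (no_types, lifting) length_map length_zip min.idem nth_map nth_mem
          nth_zip old.prod.case)
    then show ?thesis by (rule multilinearC_zero[OF ad_homogeneous_multilinear])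
  qed
  have map: "map2 (current_part p) ds ws = ws"
    using len ws by (intro nth_equalityI) auto
  have inner: "(\<Sum>es | length es = length ws.
      ad_homogeneous p d' y es (map2 (current_part p) es ws)) = ad_homogeneous p d' y ds ws" for d' y
  proof -
    have "(\<Sum>es | length es = length ws.
        ad_homogeneous p d' y es (map2 (current_part p) es ws)) =
      (\<Sum>es\<in>{ds}. ad_homogeneous p d' y es (map2 (current_part p) es ws))"
      using fin len by (intro sum.mono_neutral_right) (auto simp: vanish)
    then show ?thesis by (simp add: map)
  qed
  have tz: "(0 :: 'a gl) \<otimes>\<^sub>C (1 :: 'b) = 0"
    using tensor_bilinear[where 'a = "'a gl" and 'b = 'b] unfolding bilinearC_def
    by (metis complex_vector.scale_zero_left)
  have bz: "current_bracket p 0 w = 0" for w :: "('a, 'b) gl_tensor"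
    using tensor_lift_scaleC[OF bilinearC_bracket_left, of p w 0 0]
    by (simp add: current_bracket_def)
  have zero: "ad_homogeneous p d' 0 ds ws = 0" for d'
    unfolding ad_homogeneous_def
    by (intro sum.neutral ballI)
      (simp add: tz bz multilinearC_zero[OF tprod_multilinear] set_update_memI)
  have other: "gl_part p d' x = (if d' = d then x else 0)" for d'
    using gl_part_gl_part[of p d' d x] x by auto
  show ?thesis
    unfolding ad_def talg_lift_tprod[OF ad_multilinear]
    unfolding inner sum_UNIV_bit ad_homogeneous_def[symmetric]
    by (cases d) (simp_all add: other zero)
qed


section \<open>The invariant elements\<close>

text \<open>
  Indices are counted from 0 here, so the cyclic successor of \<^term>\<open>j\<close> is \<^term>\<open>Suc j mod k\<close>
  and the sign leaves out the parity of the first index \<open>is ! 0\<close>.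
\<close>

definition T_tilde ::
  "('i::finite \<Rightarrow> bit) \<Rightarrow> 'b::comm_complex_algebra list \<Rightarrow> ('i, 'b) gl_tensor tensor_algebra" where
  "T_tilde p as =
     (let k = length as in
      \<Sum>is | length is = k. msign (\<Sum>j = 1..<k. p (is ! j)) *\<^sub>C
        tprod (map (\<lambda>j. matrix_unit (is ! j) (is ! (Suc j mod k)) \<otimes>\<^sub>C (as ! j)) [0..<k]))"

lemma T_tilde_in_tensor_power: "T_tilde p as \<in> tensor_power (length as)"
  unfolding T_tilde_def tensor_power_def Let_def
  by (intro complex_vector.span_sum complex_vector.span_scale complex_vector.span_base) auto

end

theory Submission
  imports Defs
begin

text \<open>
  By linearity in \<^term>\<open>x\<close> it suffices to treat a matrix unit \<open>E\<^sub>a\<^sub>b\<close>. Acting on the letter with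
  index pair \<open>(i\<^sub>r, i\<^sub>r\<^sub>+\<^sub>1)\<close>, it produces a term which replaces the row index \<open>i\<^sub>r = b\<close> by \<open>a\<close> and one
  which replaces the column index \<open>i\<^sub>r\<^sub>+\<^sub>1 = a\<close> by \<open>b\<close>. Summed over all words, the row terms at the
  cyclic position \<open>r + 1\<close> cancel the column terms at position \<open>r\<close>: both run over the closed words in
  which the junction of the letters \<open>r\<close> and \<open>r + 1\<close> has column index \<open>b\<close> and row index \<open>a\<close>.
\<close>

section \<open>Linearity of the adjoint action in the acting element\<close>

text \<open>Multilinearity of \<open>tprod\<close> phrased with list updates, the form in which
  \<open>ad_homogeneous\<close> changes a letter.\<close>

lemma tprod_update_add:
  fixes ws :: "'a::complex_vector list"
  assumes "r < length ws"
  shows "tprod (ws[r := x + y]) = tprod (ws[r := x]) + tprod (ws[r := y])"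
  using assms tprod_multilinear[where 'a = 'a]
  by (simp add: multilinearC_def upd_conv_take_nth_drop)

lemma tprod_update_scaleC:
  fixes ws :: "'a::complex_vector list"
  assumes "r < length ws"
  shows "tprod (ws[r := c *\<^sub>C x]) = c *\<^sub>C tprod (ws[r := x])"
  using assms tprod_multilinear[where 'a = 'a]
  by (simp add: multilinearC_def upd_conv_take_nth_drop)

lemma tprod_update_diff:
  assumes "r < length ws"
  shows "tprod (ws[r := x - y]) = tprod (ws[r := x]) - tprod (ws[r := y])"
  using tprod_update_add[OF assms, of "x - y" y] by simp

lemma tprod_update_zero:
  assumes "r < length ws"
  shows "tprod (ws[r := 0]) = 0"
  using tprod_update_add[OF assms, of 0 0] by simp

lemma tensor_add_left: "(x + y) \<otimes>\<^sub>C z = x \<otimes>\<^sub>C z + y \<otimes>\<^sub>C z"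
  using tensor_bilinear unfolding bilinearC_def by blast

lemma tensor_scaleC_left: "(c *\<^sub>C x) \<otimes>\<^sub>C z = c *\<^sub>C (x \<otimes>\<^sub>C z)"
  using tensor_bilinear unfolding bilinearC_def by blast

lemma tensor_diff_left: "(x - y) \<otimes>\<^sub>C z = x \<otimes>\<^sub>C z - y \<otimes>\<^sub>C z"
  using tensor_add_left[of "x - y" y z] by simp

lemma tensor_zero_left: "0 \<otimes>\<^sub>C z = 0"
  using tensor_add_left[of 0 0 z] by simp

lemma current_bracket_add_left:
  "current_bracket p (v + v') w = current_bracket p v w + current_bracket p v' w"
  unfolding current_bracket_def by (rule tensor_lift_add[OF bilinearC_bracket_left])

lemma current_bracket_scaleC_left:
  "current_bracket p (c *\<^sub>C v) w = c *\<^sub>C current_bracket p v w"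
  unfolding current_bracket_def by (rule tensor_lift_scaleC[OF bilinearC_bracket_left])

lemma ad_homogeneous_add_left:
  "ad_homogeneous p d (x + y) ds ws = ad_homogeneous p d x ds ws + ad_homogeneous p d y ds ws"
  by (simp add: ad_homogeneous_def tensor_add_left current_bracket_add_left tprod_update_add
      scaleC_add_right sum.distrib)

lemma ad_homogeneous_scaleC_left:
  "ad_homogeneous p d (c *\<^sub>C x) ds ws = c *\<^sub>C ad_homogeneous p d x ds ws"
  by (simp add: ad_homogeneous_def tensor_scaleC_left current_bracket_scaleC_left
      tprod_update_scaleC complex_vector.scale_sum_right scaleC_scaleC mult.commute)

text \<open>\<open>talg_lift\<close> evaluates at one fixed representative of \<open>t\<close>, so
  linearity in the acting element is inherited summand by summand from
  \<open>ad_homogeneous\<close>.\<close>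

lemma ad_add_left: "ad p (x + y) t = ad p x t + ad p y t"
  by (simp add: ad_def talg_lift_def free_lift_def gl_part_add ad_homogeneous_add_left
      sum.distrib scaleC_add_right)

lemma ad_scaleC_left: "ad p (c *\<^sub>C x) t = c *\<^sub>C ad p x t"
  by (simp add: ad_def talg_lift_def free_lift_def gl_part_scaleC ad_homogeneous_scaleC_left
      complex_vector.scale_sum_right scaleC_scaleC mult.commute)

lemma ad_sum: "ad p x (\<Sum>i\<in>I. f i) = (\<Sum>i\<in>I. ad p x (f i))"
proof -
  have "module_hom scaleC scaleC (ad p x)"
    by unfold_locales (rule ad_add ad_scaleC)+
  then show ?thesis by (rule module_hom.sum)
qed

lemma ad_sum_left: "ad p (\<Sum>i\<in>I. f i) t = (\<Sum>i\<in>I. ad p (f i) t)"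
proof -
  have "module_hom scaleC scaleC (\<lambda>x. ad p x t)"
    by unfold_locales (rule ad_add_left ad_scaleC_left)+
  then show ?thesis by (rule module_hom.sum)
qed


section \<open>Matrix units\<close>

lemma matrix_unit_expansion: "x = (\<Sum>a\<in>UNIV. \<Sum>b\<in>UNIV. (x $ a $ b) *\<^sub>C matrix_unit a b)"
proof -
  have "(\<Sum>a\<in>UNIV. \<Sum>b\<in>UNIV. x $ a $ b * (if r = a \<and> s = b then 1 else 0)) = x $ r $ s" for r s
  proof -
    have "(\<Sum>b\<in>UNIV. x $ a $ b * (if r = a \<and> s = b then 1 else 0)) =
        (if r = a then x $ a $ s else 0)" for a
      by (cases "r = a") (simp_all add: if_distrib[of "(*) _"] cong: if_cong)
    then show ?thesis by simp
  qed
  then show ?thesis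
    by (simp add: vec_eq_iff scaleC_vec_def scaleC_complex_def matrix_unit_def)
qed

lemma gl_part_matrix_unit: "gl_part p (p i + p j) (matrix_unit i j) = matrix_unit i j"
  by (auto simp: gl_part_def matrix_unit_def vec_eq_iff)

lemma matrix_unit_mult:
  "matrix_unit a b ** matrix_unit i j = (if b = i then matrix_unit a j else 0)"
proof -
  have "(\<Sum>k\<in>UNIV. (if r = a \<and> k = b then 1 else 0) * (if k = i \<and> s = j then 1 else 0)) =
      (if r = a \<and> b = i \<and> s = j then 1 else (0 :: complex))" for r s
  proof -
    have "(\<Sum>k\<in>UNIV. (if r = a \<and> k = b then 1 else 0) * (if k = i \<and> s = j then 1 else 0)) =
        (\<Sum>k\<in>UNIV. if k = b then (if r = a \<and> b = i \<and> s = j then 1 else (0 :: complex)) else 0)"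
      by (intro sum.cong) auto
    then show ?thesis by simp
  qed
  then show ?thesis
    by (auto simp: matrix_matrix_mult_def matrix_unit_def vec_eq_iff)
qed

lemma gl_bracket_matrix_unit:
  "gl_bracket p (matrix_unit a b) (matrix_unit i j) =
     (if b = i then matrix_unit a j else 0) -
     msign ((p a + p b) * (p i + p j)) *\<^sub>C (if j = a then matrix_unit i b else 0)"
  by (simp add: gl_bracket_homogeneous[OF gl_part_matrix_unit gl_part_matrix_unit] matrix_unit_mult)


section \<open>The action of a matrix unit on closed words\<close>

lemma msign_mult: "msign x * msign y = msign (x + y)"
  by (cases x; cases y) (simp_all add: msign_def)

text \<open>Row and column indices are separate functions because the action breaks the word open at
  one junction, where they then disagree.\<close>

definition word :: "'b::comm_complex_algebra list \<Rightarrow> (nat \<Rightarrow> 'i::finite) \<Rightarrow> (nat \<Rightarrow> 'i)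
    \<Rightarrow> ('i, 'b) gl_tensor tensor_algebra" where
  "word as u v = tprod (map (\<lambda>j. matrix_unit (u j) (v j) \<otimes>\<^sub>C as ! j) [0..<length as])"

lemma word_cong:
  assumes "\<And>j. j < length as \<Longrightarrow> u j = u' j" "\<And>j. j < length as \<Longrightarrow> v j = v' j"
  shows "word as u v = word as u' v'"
  unfolding word_def using assms by (intro arg_cong[where f = tprod] map_cong) auto

lemma word_update:
  assumes "r < length as"
  shows "tprod ((map (\<lambda>j. matrix_unit (u j) (v j) \<otimes>\<^sub>C as ! j) [0..<length as])
      [r := matrix_unit i j \<otimes>\<^sub>C as ! r]) = word as (u(r := i)) (v(r := j))"
  unfolding word_def
  by (intro arg_cong[where f = tprod] nth_equalityI) (use assms in \<open>auto simp: nth_list_update\<close>)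

lemma ad_matrix_unit_word:
  "ad p (matrix_unit a b) (word as u v) =
    (\<Sum>r<length as. msign ((p a + p b) * (\<Sum>j<r. p (u j) + p (v j))) *\<^sub>C
      ((if u r = b then word as (u(r := a)) v else 0) -
       msign ((p a + p b) * (p (u r) + p (v r))) *\<^sub>C
         (if v r = a then word as u (v(r := b)) else 0)))"
proof -
  define k where "k = length as"
  define ws where "ws = map (\<lambda>j. matrix_unit (u j) (v j) \<otimes>\<^sub>C as ! j) [0..<k]"
  define ds where "ds = map (\<lambda>j. p (u j) + p (v j)) [0..<k]"
  have len: "length ws = k" by (simp add: ws_def)
  have "ad p (matrix_unit a b) (tprod ws) =
    (\<Sum>r<k. msign ((p a + p b) * sum_list (take r ds)) *\<^sub>C
       tprod (ws[r := current_bracket p (matrix_unit a b \<otimes>\<^sub>C 1) (ws ! r)]))"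
    \<comment> \<open>Sums of parities must stay sums, not become exclusive ors, for
      \<open>gl_part_matrix_unit\<close> to match.\<close>
    using ad_tprod_homogeneous[OF gl_part_matrix_unit, of ds ws p a b]
    by (simp add: ws_def ds_def current_part_tensor gl_part_matrix_unit del: add_bit_eq_xor)
  also have "\<dots> = (\<Sum>r<k. msign ((p a + p b) * (\<Sum>j<r. p (u j) + p (v j))) *\<^sub>C
      ((if u r = b then word as (u(r := a)) v else 0) -
       msign ((p a + p b) * (p (u r) + p (v r))) *\<^sub>C
         (if v r = a then word as u (v(r := b)) else 0)))"
  proof (intro sum.cong arg_cong2[where f = scaleC] refl)
    fix r assume "r \<in> {..<k}"
    then have r: "r < k" by simp
    have "sum_list (take r ds) = (\<Sum>j<r. p (u j) + p (v j))"
      using r by (simp add: ds_def take_map sum_list_distinct_conv_sum_set lessThan_atLeast0)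
    then show "msign ((p a + p b) * sum_list (take r ds)) =
        msign ((p a + p b) * (\<Sum>j<r. p (u j) + p (v j)))" by simp
    have upd: "tprod (ws[r := matrix_unit i j \<otimes>\<^sub>C as ! r]) = word as (u(r := i)) (v(r := j))" for i j
      using word_update[of r as u v i j] r by (simp add: ws_def k_def)
    have "ws ! r = matrix_unit (u r) (v r) \<otimes>\<^sub>C as ! r" using r by (simp add: ws_def)
    then show "tprod (ws[r := current_bracket p (matrix_unit a b \<otimes>\<^sub>C 1) (ws ! r)]) =
      (if u r = b then word as (u(r := a)) v else 0) -
       msign ((p a + p b) * (p (u r) + p (v r))) *\<^sub>C
         (if v r = a then word as u (v(r := b)) else 0)"
      using r upd[of a "v r"] upd[of "u r" b]
      by (auto simp: current_bracket_tensor gl_bracket_matrix_unit tensor_diff_left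
          tensor_scaleC_left tensor_zero_left tprod_update_diff tprod_update_scaleC
          tprod_update_zero len)
  qed
  finally show ?thesis by (simp add: word_def ws_def k_def)
qed

section \<open>Cyclic indices and parities along a closed word\<close>

lemma sum_cyclic_shift: "(\<Sum>r<k. f (Suc r mod k)) = (\<Sum>r<k. f r)" for k :: nat
proof (cases k)
  case (Suc n)
  have "(\<Sum>r<Suc n. f (Suc r mod Suc n)) = (\<Sum>r<n. f (Suc r)) + f 0"
    by simp
  also have "\<dots> = (\<Sum>r<Suc n. f r)"
    by (simp add: sum.lessThan_Suc_shift add.commute del: sum.lessThan_Suc)
  finally show ?thesis using Suc by simp
qed simp

lemma bit_add_self: "(x :: bit) + x = 0" by (cases x) simp_all

text \<open>The sum telescopes modulo 2, and no index wraps around before \<open>r < k\<close>.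
  Hence the Koszul sign at a letter depends only on the first index and on its row index.\<close>

lemma sum_closed_path_parity:
  fixes q :: "nat \<Rightarrow> bit"
  assumes "r < k"
  shows "(\<Sum>j<r. q j + q (Suc j mod k)) = q 0 + q r"
  using assms
proof (induction r)
  case (Suc r)
  have "(q 0 + q r) + (q r + q (Suc r)) = q 0 + (q r + q r) + q (Suc r)"
    by (simp only: add.assoc)
  with Suc show ?case by (simp only: sum.lessThan_Suc) (simp add: bit_add_self)
qed (simp add: bit_add_self)

lemma Suc_mod_eq_iff:
  assumes "j < k" "r < k"
  shows "Suc j mod k = Suc r mod k \<longleftrightarrow> j = r"
  using assms by (auto simp: mod_Suc split: if_splits)

text \<open>The sign of the word in \<open>T_tilde\<close> times the Koszul sign for moving an
  element of degree \<open>d\<close> past the letters before \<open>m\<close>.\<close>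

definition junction_sign :: "('i \<Rightarrow> bit) \<Rightarrow> bit \<Rightarrow> nat \<Rightarrow> 'i list \<Rightarrow> complex" where
  "junction_sign p d m is =
     msign ((\<Sum>j = 1..<length is. p (is ! j)) + d * (p (is ! 0) + p (is ! m)))"

text \<open>
  At \<open>m > 0\<close> the update changes the exponent by \<open>d + d * d = 0\<close>; at \<open>m = 0\<close> the exponent does not
  involve the first index at all.
\<close>

lemma junction_sign_update:
  assumes m: "m < length is" and d: "d = p a + p (is ! m)"
  shows "junction_sign p d m (is[m := a]) = junction_sign p d m is"
proof (cases "m = 0")
  case True
  then show ?thesis using m by (simp add: junction_sign_def bit_add_self)
next
  case False
  define rest where "rest = (\<Sum>j \<in> {1..<length is} - {m}. p (is ! j))"
  have "(\<Sum>j = 1..<length is. p (is[m := a] ! j)) = p a + rest"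
    and "(\<Sum>j = 1..<length is. p (is ! j)) = p (is ! m) + rest"
    using m False by (simp_all add: sum.remove[of _ m] rest_def)
  then show ?thesis
    using m False unfolding d junction_sign_def
    by (cases "p a"; cases "p (is ! m)"; cases "p (is ! 0)"; cases rest) simp_all
qed

section \<open>Cancellation of row and column terms at each junction\<close>

lemma ad_matrix_unit_T_tilde:
  fixes as :: "'b::comm_complex_algebra list" and p :: "'i::finite \<Rightarrow> bit"
  shows "ad p (matrix_unit a b) (T_tilde p as) = 0"
proof -
  define k where "k = length as"
  define d where "d = p a + p b"
  define nxt where "nxt is = (\<lambda>j. is ! (Suc j mod k))" for "is" :: "'i list"
  define I where "I = {is :: 'i list. length is = k}"
  define row where "row r is =
    (if is ! r = b then junction_sign p d r is *\<^sub>C word as (((!) is)(r := a)) (nxt is) else 0)" for r "is"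
  define col where "col r is =
    (if nxt is r = a then junction_sign p d (Suc r mod k) is *\<^sub>C word as ((!) is) ((nxt is)(r := b))
     else 0)" for r "is"
  have word: "msign (\<Sum>j = 1..<k. p (is ! j)) *\<^sub>C ad p (matrix_unit a b) (word as ((!) is) (nxt is)) =
      (\<Sum>r<k. row r is - col r is)" if "is \<in> I" for "is"
    unfolding ad_matrix_unit_word complex_vector.scale_sum_right k_def[symmetric] d_def[symmetric]
  proof (rule sum.cong[OF refl])
    fix r assume "r \<in> {..<k}"
    then have path: "(\<Sum>j<r. p (is ! j) + p (nxt is j)) = p (is ! 0) + p (is ! r)"
      using sum_closed_path_parity[of r k "\<lambda>j. p (is ! j)"] by (simp add: nxt_def)
    have len: "length is = k" using that by (simp add: I_def)
    \<comment> \<open>The bracket's own sign for passing letter \<open>r\<close> moves the endpoint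
      one index on, so a column term carries the junction sign of the next position.\<close>
    have "d * (p (is ! 0) + p (is ! r)) + d * (p (is ! r) + p (nxt is r)) =
        d * (p (is ! 0) + p (nxt is r))"
      by (cases "p (is ! r)"; cases "p (is ! 0)"; cases "p (nxt is r)") simp_all
    then show "msign (\<Sum>j = 1..<k. p (is ! j)) *\<^sub>C msign (d * (\<Sum>j<r. p (is ! j) + p (nxt is j))) *\<^sub>C
        ((if is ! r = b then word as (((!) is)(r := a)) (nxt is) else 0) -
         msign (d * (p (is ! r) + p (nxt is r))) *\<^sub>C
           (if nxt is r = a then word as ((!) is) ((nxt is)(r := b)) else 0)) =
        row r is - col r is"
      unfolding path row_def col_def junction_sign_def len
      by (simp add: complex_vector.scale_right_diff_distrib scaleC_scaleC msign_mult mult.assoc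
          nxt_def)
  qed
  have cancel: "(\<Sum>is\<in>I. row (Suc r mod k) is) = (\<Sum>is\<in>I. col r is)" if r: "r < k" for r
  proof -
    define m where "m = Suc r mod k"
    have m: "m < k" using r by (simp add: m_def)
    have fin: "finite I"
      using finite_lists_length_eq[of "UNIV :: 'i set" k] by (simp add: I_def)
    have "(\<Sum>is\<in>I. row m is) = (\<Sum>is\<in>{is\<in>I. is ! m = b}. row m is)"
      using fin by (intro sum.mono_neutral_right) (auto simp: row_def)
    also have "\<dots> = (\<Sum>is\<in>{is\<in>I. is ! m = a}. col r is)"
    \<comment> \<open>Entry \<open>m\<close> is both the row index of letter \<open>m\<close> and
      the column index of letter \<open>r\<close>. Overwriting it pairs a row term with the column
      term that yields the same broken word.\<close>
    proof (rule sum.reindex_bij_witness[where i = "\<lambda>is. is[m := b]" and j = "\<lambda>is. is[m := a]"])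
      fix "is" assume "is \<in> {is\<in>I. is ! m = b}"
      then have len: "length is = k" and b: "is ! m = b" by (simp_all add: I_def)
      show "is[m := a, m := b] = is" using b by (metis list_update_id list_update_overwrite)
      show "is[m := a] \<in> {is\<in>I. is ! m = a}" using len m by (simp add: I_def)
      have "word as ((!) (is[m := a])) ((nxt (is[m := a]))(r := b)) =
          word as (((!) is)(m := a)) (nxt is)"
      proof (rule word_cong)
        fix j assume "j < length as"
        then have j: "j < k" by (simp add: k_def)
        show "is[m := a] ! j = (((!) is)(m := a)) j" using j len by (simp add: nth_list_update)
        \<comment> \<open>The cyclic successor is injective, so only letter \<open>r\<close> reads
          its column index from entry \<open>m\<close>, and resetting that index to \<open>b\<close>
          restores all columns.\<close>
        show "((nxt (is[m := a]))(r := b)) j = nxt is j"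
          using Suc_mod_eq_iff[OF j r] b by (auto simp: nxt_def m_def)
      qed
      then show "col r (is[m := a]) = row m is"
        using b len m junction_sign_update[of m "is" d p a]
        by (simp add: row_def col_def nxt_def d_def flip: m_def)
    next
      fix "is" assume "is \<in> {is\<in>I. is ! m = a}"
      then have len: "length is = k" and a: "is ! m = a" by (simp_all add: I_def)
      show "is[m := b, m := a] = is" using a by (metis list_update_id list_update_overwrite)
      show "is[m := b] \<in> {is\<in>I. is ! m = b}" using len m by (simp add: I_def)
    qed
    also have "\<dots> = (\<Sum>is\<in>I. col r is)"
      using fin by (intro sum.mono_neutral_left) (auto simp: col_def nxt_def m_def)
    finally show ?thesis by (simp add: m_def)
  qed
  have "ad p (matrix_unit a b) (T_tilde p as) = (\<Sum>is\<in>I. msign (\<Sum>j = 1..<k. p (is ! j)) *\<^sub>C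
      ad p (matrix_unit a b) (word as ((!) is) (nxt is)))"
    by (simp add: T_tilde_def Let_def ad_sum ad_scaleC I_def word_def nxt_def k_def)
  also have "\<dots> = (\<Sum>is\<in>I. \<Sum>r<k. row r is - col r is)"
    by (rule sum.cong[OF refl word])
  \<comment> \<open>The cancellation pairs terms of different words, so the position is fixed first
    and the words are summed inside.\<close>
  also have "\<dots> = (\<Sum>r<k. \<Sum>is\<in>I. row r is) - (\<Sum>r<k. \<Sum>is\<in>I. col r is)"
    by (subst sum.swap) (simp add: sum_subtractf)
  also have "(\<Sum>r<k. \<Sum>is\<in>I. col r is) = (\<Sum>r<k. \<Sum>is\<in>I. row (Suc r mod k) is)"
    by (simp add: cancel)
  also have "\<dots> = (\<Sum>r<k. \<Sum>is\<in>I. row r is)"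
    by (rule sum_cyclic_shift)
  finally show ?thesis by simp
qed

theorem lemma4p2:
  fixes M N :: nat
    and p :: "'i::finite \<Rightarrow> bit"
    and x :: "'i gl"
    and as :: "'b::comm_complex_algebra list"
  assumes "card {i. p i = 0} = M"
    and "card {i. p i = 1} = N"
    and "M + N \<ge> 3"
    and "finitely_generated_algebra TYPE('b)"
  shows "ad p x (T_tilde p as) = 0"
  by (subst matrix_unit_expansion) (simp add: ad_sum_left ad_scaleC_left ad_matrix_unit_T_tilde)

end
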